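(* Let $\varphi_4:\mathbb{N}\to\mathbb{N}$ be the function defined as follows. The values $\varphi_4(0),\varphi_4(1),\dots,\varphi_4(29)$ are, in order, $$4,5,3,2,0,1,7,6,10,11,\ 8,9,14,15,12,13,18,19,16,17,\ 22,23,20,21,26,27,24,25,28,29,$$ and for $x\ge 30$, $\varphi_4(x)=x\oplus_2 2$. Then, for all nonnegative integers $a,b$, the Halve Nim position $a^1b^14^1$ is a $\mathcal{P}$-position if and only if $b=\varphi_4(a)$. Furthermore, for $a,b\ge 30$, $a^1b^14^1$ is a $\mathcal{P}$-position if and only if $(a+2)\oplus(b+2)=2$.
   Context: $\mathbb{N}$ is the set of nonnegative integers and $\oplus$ denotes bitwise XOR. The $n$-shifted bitwise sum is $x\oplus_n y=\bigl((x+n)\oplus y\bigr)-n$. Halve Nim is a two-player game played on finitely many piles of coins; players alternate moves and a player who cannot move loses. A move is one of: (i) choose one pile and remove at least one coin from it; (ii) halve the game: simultaneously replace every pile of $m$ coins by a pile of $\lfloor m/2\rfloor$ coins. When there are no coins left, no move is available (halving requires at least one coin to be present). A position is a $\mathcal{P}$-position if the player who is not about to move has a winning strategy (equivalently, every move from it leads to an $\mathcal{N}$-position), and an $\mathcal{N}$-position if the player about to move has a winning strategy. $a^1b^1c^1$ denotes the position with three piles of sizes $a$, $b$, $c$ (a pile of size $0$ is an empty pile); in particular $a^1b^14^1$ has piles of sizes $a$, $b$, $4$. *)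

theory Defs
  imports Main "HOL-Library.Multiset"
begin

unbundle bit_operations_syntax

(* A position is the multiset of its pile sizes; piles of size 0 may occur and are inert. *)

type_synonym position = "nat multiset"

inductive halve_nim_move :: "position \<Rightarrow> position \<Rightarrow> bool" where
  remove_coins: "k < m \<Longrightarrow> halve_nim_move (add_mset m M) (add_mset k M)"
| halve: "\<exists>m \<in># M. m > 0 \<Longrightarrow> halve_nim_move M (image_mset (\<lambda>m. m div 2) M)"

(* The least fixed point expresses that the respective player can force a win in finitely
   many moves. The player to move loses when no move is available, which is the base case
   of P_intro. *)

inductive P_position :: "position \<Rightarrow> bool" and N_position :: "position \<Rightarrow> bool" where
  P_intro: "(\<And>q. halve_nim_move p q \<Longrightarrow> N_position q) \<Longrightarrow> P_position p"
| N_intro: "halve_nim_move p q \<Longrightarrow> P_position q \<Longrightarrow> N_position p"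

lemma sum_mset_div2_less:
  fixes M :: "nat multiset"
  assumes "\<exists>m \<in># M. m > 0"
  shows "(\<Sum>m\<in>#M. m div 2) < sum_mset M"
proof -
  from assms obtain m K where M: "M = add_mset m K" and m: "m > 0"
    by (metis multi_member_split)
  have "(\<Sum>x\<in>#K. x div 2) \<le> sum_mset K"
    by (induction K) (auto intro: add_mono)
  moreover have "m div 2 < m" using m by simp
  ultimately show ?thesis unfolding M by simp
qed

lemma halve_nim_move_decreases: "halve_nim_move p q \<Longrightarrow> sum_mset q < sum_mset p"
  by (induction rule: halve_nim_move.induct) (auto intro: sum_mset_div2_less)

lemma P_position_iff: "P_position p \<longleftrightarrow> (\<forall>q. halve_nim_move p q \<longrightarrow> N_position q)"
  by (auto intro: P_intro elim: P_position.cases)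

lemma N_position_iff: "N_position p \<longleftrightarrow> (\<exists>q. halve_nim_move p q \<and> P_position q)"
  by (auto intro: N_intro elim: N_position.cases)

lemma N_position_iff_not_P: "N_position p \<longleftrightarrow> \<not> P_position p"
proof (induction "sum_mset p" arbitrary: p rule: less_induct)
  case less
  have "N_position q \<longleftrightarrow> \<not> P_position q" if "halve_nim_move p q" for q
    using less halve_nim_move_decreases[OF that] by blast
  then show ?case
    by (metis N_position_iff P_position_iff)
qed

(* shifted_xor n x y is x \<oplus>_n y. The subtraction is truncated, so this is the intended
   value only if n \<le> (x + n) XOR y; see phi4_no_truncation. *)

definition shifted_xor :: "nat \<Rightarrow> nat \<Rightarrow> nat \<Rightarrow> nat" where
  "shifted_xor n x y = ((x + n) XOR y) - n"

definition phi4 :: "nat \<Rightarrow> nat" where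
  "phi4 x =
    (if x < 30 then
       [4, 5, 3, 2, 0, 1, 7, 6, 10, 11,
        8, 9, 14, 15, 12, 13, 18, 19, 16, 17,
        22, 23, 20, 21, 26, 27, 24, 25, 28, 29] ! x
     else shifted_xor 2 x 2)"

lemma phi4_no_truncation:
  assumes "x \<ge> 30"
  shows "int (phi4 x) = int ((x + 2) XOR 2) - 2"
proof -
  have "(x + 2) XOR 2 \<ge> 2"
  proof (rule ccontr)
    assume "\<not> 2 \<le> (x + 2) XOR 2"
    then have "(x + 2) XOR 2 = 0 \<or> (x + 2) XOR 2 = 1" by linarith
    moreover have "((x + 2) XOR 2) XOR 2 = x + 2" by (simp add: xor.assoc)
    ultimately have "x + 2 = 0 XOR 2 \<or> x + 2 = 1 XOR 2" by metis
    with assms show False by auto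
  qed
  with assms show ?thesis by (simp add: phi4_def shifted_xor_def of_nat_diff)
qed

end

(* Let phi c be the involution whose graph is the set of pairs (a, b) for which a, b, c is a
   P-position. For all c \<le> 4 it is determined simultaneously, since a move never leaves
   the triples with third pile at most 4. Away from small piles phi 0, ..., phi 3 preserve
   every block {4q, ..., 4q+3} and act on it by XOR with c or with c XOR 2, while
   phi 4 is XOR with 2 on blocks shifted by 2. Which of the two constants occurs for c < 4
   is forced by halving, which maps block q to block q div 2: it alternates between the
   intervals 7 * 2^k \<le> q < 14 * 2^k. Correctness is then a finite check below 64 and an
   eightfold residue analysis above. *)

theory Submission
  imports Defs
begin

section \<open>Moves and P-positions with three piles\<close>

lemma halve_nim_move_triple_iff:
  "halve_nim_move {#a, b, c#} q \<longleftrightarrow>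
    (\<exists>x<a. q = {#x, b, c#}) \<or> (\<exists>x<b. q = {#a, x, c#}) \<or> (\<exists>x<c. q = {#a, b, x#}) \<or>
    (0 < a + b + c \<and> q = {#a div 2, b div 2, c div 2#})" (is "?L \<longleftrightarrow> ?R")
proof
  assume ?L
  then show ?R
  proof cases
    case (remove_coins k m M)
    have "m \<in># {#a, b, c#}"
      using remove_coins(1) by (metis union_single_eq_member add_mset_add_single)
    then consider "m = a" | "m = b" | "m = c" by auto
    then show ?thesis
    proof cases
      case 1
      then have "M = {#b, c#}" using remove_coins(1) by simp
      then show ?thesis using 1 remove_coins by auto
    next
      case 2
      then have "M = {#a, c#}" using remove_coins(1) by (simp add: add_mset_commute)
      then show ?thesis using 2 remove_coins by (auto simp: add_mset_commute)
    next
      case 3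
      have "{#a, b, c#} = add_mset c {#a, b#}" by (simp add: add_mset_commute)
      then have "M = {#a, b#}" using 3 remove_coins(1) by (metis add_mset_add_mset_same_iff)
      then have "q = {#a, b, k#}" using 3 remove_coins by (simp add: add_mset_commute)
      then show ?thesis using 3 remove_coins by auto
    qed
  next
    case halve
    then show ?thesis by auto
  qed
next
  assume ?R
  then consider x where "x < a" "q = {#x, b, c#}" | x where "x < b" "q = {#a, x, c#}"
    | x where "x < c" "q = {#a, b, x#}" | "0 < a + b + c" "q = {#a div 2, b div 2, c div 2#}"
    by blast
  then show ?L
  proof cases
    case 1
    then show ?thesis by (simp add: halve_nim_move.remove_coins)
  next
    case (2 x)
    then have "halve_nim_move (add_mset b {#a, c#}) (add_mset x {#a, c#})"
      by (simp only: halve_nim_move.remove_coins)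
    then show ?thesis using 2 by (simp add: add_mset_commute)
  next
    case (3 x)
    then have "halve_nim_move (add_mset c {#a, b#}) (add_mset x {#a, b#})"
      by (simp only: halve_nim_move.remove_coins)
    then show ?thesis using 3 by (simp add: add_mset_commute)
  next
    case 4
    then have "\<exists>m \<in># {#a, b, c#}. m > 0" by auto
    from halve_nim_move.halve[OF this] show ?thesis using 4 by simp
  qed
qed

lemma P_position_triple_iff:
  "P_position {#a, b, c#} \<longleftrightarrow>
    (\<forall>x<a. \<not> P_position {#x, b, c#}) \<and> (\<forall>x<b. \<not> P_position {#a, x, c#}) \<and>
    (\<forall>x<c. \<not> P_position {#a, b, x#}) \<and>
    (0 < a + b + c \<longrightarrow> \<not> P_position {#a div 2, b div 2, c div 2#})"
  by (subst P_position_iff) (auto simp: halve_nim_move_triple_iff N_position_iff_not_P)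

text \<open>\<open>invol\<close> and \<open>distinct\<close> rule out removals between two graph
  positions, \<open>halve_leaves\<close> rules out halvings. Off the graph, \<open>b > f c a\<close>
  is answered by a removal from the second pile and \<open>a > f c b\<close> by one from the first.
  Hence \<open>reach\<close> only has to supply a move, on the third pile or by halving, when both
  piles are too small.\<close>

lemma P_position_triple_criterion:
  fixes f :: "nat \<Rightarrow> nat \<Rightarrow> nat"
  assumes invol: "\<And>c a. c \<le> n \<Longrightarrow> f c (f c a) = a"
    and distinct: "\<And>c d a. c < d \<Longrightarrow> d \<le> n \<Longrightarrow> f c a \<noteq> f d a"
    and halve_leaves: "\<And>c a. c \<le> n \<Longrightarrow> 0 < a + f c a + c \<Longrightarrow> f (c div 2) (a div 2) \<noteq> f c a div 2"
    and reach: "\<And>c a b. c \<le> n \<Longrightarrow> b < f c a \<Longrightarrow> a < f c b \<Longrightarrow>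
      (\<exists>d<c. f d a = b) \<or> f (c div 2) (a div 2) = b div 2"
    and "c \<le> n"
  shows "P_position {#a, b, c#} \<longleftrightarrow> b = f c a"
  using \<open>c \<le> n\<close>
proof (induction "a + b + c" arbitrary: a b c rule: less_induct)
  case less
  note c = \<open>c \<le> n\<close>
  have half: "P_position {#a div 2, b div 2, c div 2#} \<longleftrightarrow> b div 2 = f (c div 2) (a div 2)"
    if "0 < a + b + c"
    using that c by (intro less.hyps) linarith+
  have "P_position {#x, b, c#} \<longleftrightarrow> b = f c x" if "x < a" for x
    using that c by (intro less.hyps) simp_all
  moreover have "P_position {#a, x, c#} \<longleftrightarrow> x = f c a" if "x < b" for x
    using that c by (intro less.hyps) simp_all
  moreover have "P_position {#a, b, x#} \<longleftrightarrow> b = f x a" if "x < c" for x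
    using that c by (intro less.hyps) simp_all
  ultimately have "P_position {#a, b, c#} \<longleftrightarrow>
    (\<forall>x<a. b \<noteq> f c x) \<and> (\<forall>x<b. x \<noteq> f c a) \<and> (\<forall>x<c. b \<noteq> f x a) \<and>
    (0 < a + b + c \<longrightarrow> b div 2 \<noteq> f (c div 2) (a div 2))"
    using half by (subst P_position_triple_iff) (simp cong: imp_cong)
  also have "\<dots> \<longleftrightarrow> b = f c a"
  proof
    assume b: "b = f c a"
    have "b \<noteq> f c x" if "x < a" for x
      using invol[OF c] b that by (metis less_irrefl)
    moreover have "b \<noteq> f x a" if "x < c" for x
      using distinct[OF that c] b by metis
    moreover have "b div 2 \<noteq> f (c div 2) (a div 2)" if "0 < a + b + c"
      using halve_leaves[OF c, of a] b that by metis
    ultimately show "(\<forall>x<a. b \<noteq> f c x) \<and> (\<forall>x<b. x \<noteq> f c a) \<and> (\<forall>x<c. b \<noteq> f x a) \<and>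
        (0 < a + b + c \<longrightarrow> b div 2 \<noteq> f (c div 2) (a div 2))"
      using b by blast
  next
    assume *: "(\<forall>x<a. b \<noteq> f c x) \<and> (\<forall>x<b. x \<noteq> f c a) \<and> (\<forall>x<c. b \<noteq> f x a) \<and>
        (0 < a + b + c \<longrightarrow> b div 2 \<noteq> f (c div 2) (a div 2))"
    show "b = f c a"
    proof (rule ccontr)
      assume ne: "b \<noteq> f c a"
      with * have b: "b < f c a" by (metis linorder_neqE_nat)
      have "f c b \<noteq> a" using ne invol[OF c, of b] by metis
      moreover have "\<not> f c b < a" using * invol[OF c, of b] by metis
      ultimately have a: "a < f c b" by linarith
      \<comment> \<open>In the empty position \<open>reach\<close> could only yield
        \<open>f 0 0 = 0\<close>, contradicting \<open>b < f c a\<close>.\<close>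
      have "0 < a + b + c"
        using reach[OF c b a] b by (cases "a + b + c = 0") auto
      with reach[OF c b a] * show False by metis
    qed
  qed
  finally show ?case .
qed

section \<open>The candidate involutions\<close>

fun block_phase :: "nat \<Rightarrow> bool" where
  "block_phase q = (if q < 14 then False else \<not> block_phase (q div 2))"

declare block_phase.simps [simp del]

text \<open>Row \<open>c\<close> holds the irregular beginning. The length 32 is a multiple of 4, so
  that the block formulas take over at a block boundary.\<close>

definition phi_table :: "nat list list" where
  "phi_table = [
    [0, 2, 1, 3, 4, 5, 8, 9, 6, 7, 12, 13, 10, 11, 14, 15, 16, 17, 18, 19, 20, 21, 22, 23, 24,
     25, 26, 27, 30, 31, 28, 29],
    [2, 3, 0, 1, 5, 4, 9, 8, 7, 6, 13, 12, 11, 10, 15, 14, 17, 16, 19, 18, 21, 20, 23, 22, 25,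
     24, 27, 26, 31, 30, 29, 28],
    [1, 0, 2, 4, 3, 6, 5, 7, 8, 9, 10, 11, 12, 13, 18, 19, 20, 21, 14, 15, 16, 17, 26, 27, 28,
     29, 22, 23, 24, 25, 30, 31],
    [3, 1, 4, 0, 2, 7, 6, 5, 9, 8, 11, 10, 13, 12, 19, 18, 21, 20, 15, 14, 17, 16, 27, 26, 29,
     28, 23, 22, 25, 24, 31, 30],
    [4, 5, 3, 2, 0, 1, 7, 6, 10, 11, 8, 9, 14, 15, 12, 13, 18, 19, 16, 17, 22, 23, 20, 21, 26,
     27, 24, 25, 28, 29, 32, 33]
  ]"

text \<open>For \<open>c = 4\<close> the two cases are \<open>((a + 2) XOR 2) - 2\<close> written
  out: bit 1 of \<open>a + 2\<close> is set exactly when \<open>a mod 4 < 2\<close>.\<close>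

definition phi :: "nat \<Rightarrow> nat \<Rightarrow> nat" where
  "phi c a =
    (if a < 32 then phi_table ! c ! a
     else if c = 4 then (if a mod 4 < 2 then a - 2 else a + 2)
     else 4 * (a div 4) + ((a mod 4) XOR (if block_phase (a div 4) then c else c XOR 2)))"

section \<open>Finite verification below 64\<close>

lemma all_less_numeral:
  "(\<forall>x<numeral k. P x) \<longleftrightarrow> P (pred_numeral k) \<and> (\<forall>x<pred_numeral k. P x)"
  by (simp only: numeral_eq_Suc All_less_Suc)

text \<open>The countdown of bounds ends at the literal \<open>Numeral1\<close>, which
  \<open>simp only\<close> does not rewrite to \<open>1\<close>.\<close>

lemma all_less_Numeral1: "(\<forall>x<Numeral1. P x) \<longleftrightarrow> P (0 :: nat)"
  by simp

lemmas all_less_unfold = all_less_numeral all_less_Numeral1 pred_numeral_simps BitM.simps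

lemma phi_less_32: "\<forall>c<5. \<forall>a<32. phi c a = phi_table ! c ! a"
  by (simp add: phi_def)

lemma phi_ge_32:
  assumes "32 \<le> a"
  shows "phi c a = (if c = 4 then (if a mod 4 < 2 then a - 2 else a + 2)
    else 4 * (a div 4) + ((a mod 4) XOR (if block_phase (a div 4) then c else c XOR 2)))"
  using assms by (simp add: phi_def)

lemmas phi_values = phi_less_32[unfolded all_less_unfold phi_table_def, simplified]

lemmas phi_compute = phi_values phi_ge_32 block_phase.simps

text \<open>The bound is attained, for instance by \<open>phi 3 14 = 19\<close>. The cutoff is twice
  the table length: from 64 on, both \<open>a\<close> and \<open>a div 2\<close> are in the range of
  the block formulas.\<close>

lemma phi_le_small: "\<forall>c<5. \<forall>a<64. phi c a \<le> a + 5"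
  by (simp only: all_less_unfold) (simp add: phi_compute)

lemma phi_invol_small: "\<forall>c<5. \<forall>a<64. phi c (phi c a) = a"
  by (simp only: all_less_unfold) (simp add: phi_compute)

lemma phi_distinct_small: "\<forall>d<5. \<forall>c<5. \<forall>a<64. c < d \<longrightarrow> phi c a \<noteq> phi d a"
  by (simp only: all_less_unfold) (simp add: phi_compute)

lemma phi_halve_leaves_small:
  "\<forall>c<5. \<forall>a<64. 0 < a + phi c a + c \<longrightarrow> phi (c div 2) (a div 2) \<noteq> phi c a div 2"
  by (simp only: all_less_unfold) (simp add: phi_compute)

(* By phi_le only b with |a - b| < 5 can occur, and b = a + i - 5 enumerates them (truncation
   for a < 5 merely repeats b = 0). The implication is an if-then-else because the simplifier
   then skips the conclusion whenever the premise is false. *)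

lemma phi_reach_small:
  "\<forall>c<5. \<forall>a<64. \<forall>i<10. if a + i - 5 < phi c a \<and> a < phi c (a + i - 5) then
    (0 < c \<and> phi 0 a = a + i - 5) \<or> (1 < c \<and> phi 1 a = a + i - 5) \<or>
    (2 < c \<and> phi 2 a = a + i - 5) \<or> (3 < c \<and> phi 3 a = a + i - 5) \<or>
    phi (c div 2) (a div 2) = (a + i - 5) div 2 else True"
  by (simp only: all_less_unfold) (simp add: phi_compute)

section \<open>Block structure from 32 on\<close>

lemma block_phase_double:
  assumes "7 \<le> p" "d < 2"
  shows "block_phase (2 * p + d) \<longleftrightarrow> \<not> block_phase p"
  using assms by (subst block_phase.simps) simp

lemma phi_block:
  assumes "8 \<le> q" "r < 4" "c < 4"
  shows "phi c (4 * q + r) = 4 * q + (r XOR (if block_phase q then c else c XOR 2))"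
  using assms by (simp add: phi_def)

lemma less_four_cases:
  fixes n :: nat
  assumes "n < 4"
  obtains "n = 0" | "n = 1" | "n = 2" | "n = 3"
  using assms by linarith

lemma XOR_less_four: "m < 4 \<Longrightarrow> n < 4 \<Longrightarrow> m XOR n < (4 :: nat)"
  by (elim less_four_cases) simp_all

lemma block_decomp:
  fixes a :: nat
  assumes "4 * k \<le> a"
  obtains q r where "k \<le> q" "r < 4" "a = 4 * q + r"
proof
  show "k \<le> a div 4" "a mod 4 < 4" "a = 4 * (a div 4) + a mod 4"
    using assms by auto
qed

text \<open>Offsets 0 and 1 have residue 2 and 3 modulo 4 and move up by 2; offsets 2 and 3 have
  residue 0 and 1 and move back down.\<close>

lemma phi_four_block:
  assumes "8 \<le> k" "t < 4"
  shows "phi 4 (4 * k + 2 + t) = 4 * k + 2 + (t XOR 2)"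
proof -
  have "(4 * k + 2) mod 4 = 2" "(4 * k + 3) mod 4 = 3" "(4 * k + 4) mod 4 = 0" "(4 * k + 5) mod 4 = 1"
    by presburger+
  with \<open>t < 4\<close> show ?thesis
    using assms(1) by (elim less_four_cases) (simp_all add: phi_def add.assoc)
qed

lemma shifted_block_decomp:
  fixes a :: nat
  assumes "4 * k + 2 \<le> a"
  obtains q t where "k \<le> q" "t < 4" "a = 4 * q + 2 + t"
proof -
  obtain q t where "k \<le> q" "t < 4" "a - 2 = 4 * q + t"
    by (rule block_decomp[of k "a - 2"]) (use assms in linarith)
  then show ?thesis using that[of q t] assms by simp
qed

lemma phi_div_four:
  assumes "32 \<le> a" "c < 4"
  shows "phi c a div 4 = a div 4"
proof -
  obtain q r where qr: "8 \<le> q" "r < 4" "a = 4 * q + r"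
    using block_decomp[of 8 a] assms by auto
  have "r XOR (if block_phase q then c else c XOR 2) < 4"
    using qr assms by (simp add: XOR_less_four)
  then show ?thesis
    using qr assms by (simp add: phi_block)
qed

section \<open>The hypotheses of the criterion for all \<open>a\<close>\<close>

lemma phi_le:
  assumes "c \<le> 4"
  shows "phi c a \<le> a + 5"
proof (cases "a < 64")
  case True
  then show ?thesis using phi_le_small assms by simp
next
  case False
  show ?thesis
  proof (cases "c = 4")
    case True
    obtain q t where qt: "8 \<le> q" "t < 4" "a = 4 * q + 2 + t"
      using shifted_block_decomp[of 8 a] False by auto
    then have "phi 4 a = 4 * q + 2 + (t XOR 2)" by (simp only: phi_four_block)
    with \<open>t < 4\<close> show ?thesis
      using True qt(3) by (elim less_four_cases) simp_all
  next
    case c: False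
    then have "phi c a div 4 = a div 4" using False assms by (simp add: phi_div_four)
    then show ?thesis by linarith
  qed
qed

lemma phi_invol:
  assumes "c \<le> 4"
  shows "phi c (phi c a) = a"
proof -
  consider "a < 64" | "64 \<le> a" "c = 4" | "64 \<le> a" "c < 4" using assms by linarith
  then show ?thesis
  proof cases
    case 1
    then show ?thesis using phi_invol_small assms by simp
  next
    case 2
    then obtain q t where qt: "8 \<le> q" "t < 4" "a = 4 * q + 2 + t"
      using shifted_block_decomp[of 8 a] by auto
    have "t XOR 2 < 4" using qt by (simp add: XOR_less_four)
    then have "phi 4 (phi 4 a) = 4 * q + 2 + ((t XOR 2) XOR 2)"
      using qt by (simp only: phi_four_block)
    then show ?thesis using 2 qt by (simp add: xor.assoc)
  next
    case 3
    then obtain q r where qr: "16 \<le> q" "r < 4" "a = 4 * q + r"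
      using block_decomp[of 16 a] by auto
    \<comment> \<open>The constant depends only on the block, and \<open>phi c\<close> stays in the
      block, so the same \<open>e\<close> is applied twice and cancels.\<close>
    define e where "e = (if block_phase q then c else c XOR 2)"
    have "e < 4" using 3 by (simp add: e_def XOR_less_four)
    then have "r XOR e < 4" using qr by (simp add: XOR_less_four)
    then have "phi c (phi c a) = 4 * q + ((r XOR e) XOR e)"
      using qr 3 by (simp add: phi_block e_def)
    then show ?thesis using qr by (simp add: xor.assoc)
  qed
qed

text \<open>A shifted block straddles two ordinary blocks, and XOR with 2 swaps its halves. This
  separates third pile 4 from the smaller ones, which preserve ordinary blocks.\<close>

lemma phi_four_div_four:
  assumes "32 \<le> a"
  shows "phi 4 a div 4 \<noteq> a div 4"
proof (cases "a < 34")
  \<comment> \<open>The shifted block 30 to 33 begins inside the table, below the range of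
    \<open>phi_four_block\<close>.\<close>
  case True
  with assms have "a = 32 \<or> a = 33" by linarith
  then show ?thesis by (auto simp: phi_def)
next
  case False
  obtain q t where qt: "8 \<le> q" "t < 4" "a = 4 * q + 2 + t"
    using shifted_block_decomp[of 8 a] False by auto
  then have "phi 4 a = 4 * q + 2 + (t XOR 2)" by (simp only: phi_four_block)
  with \<open>t < 4\<close> show ?thesis
    using qt(3) by (elim less_four_cases) simp_all
qed

lemma phi_distinct:
  assumes "c < d" "d \<le> 4"
  shows "phi c a \<noteq> phi d a"
proof -
  consider "a < 64" | "64 \<le> a" "d = 4" | "64 \<le> a" "d < 4" using assms by linarith
  then show ?thesis
  proof cases
    case 1
    then show ?thesis using phi_distinct_small assms by simp
  next
    case 2
    then show ?thesis
      using phi_four_div_four[of a] phi_div_four[of a c] assms by auto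
  next
    case 3
    then obtain q r where qr: "16 \<le> q" "r < 4" "a = 4 * q + r"
      using block_decomp[of 16 a] by auto
    have "c < 4" using assms by simp
    then have "phi c a = 4 * q + (r XOR (if block_phase q then c else c XOR 2))"
      "phi d a = 4 * q + (r XOR (if block_phase q then d else d XOR 2))"
      using qr 3 by (simp_all add: phi_block)
    then show ?thesis
      using \<open>c < d\<close> \<open>c < 4\<close> \<open>d < 4\<close> \<open>r < 4\<close>
      by (elim less_four_cases) simp_all
  qed
qed

text \<open>Block \<open>2 * p + d\<close> is halved into block \<open>p\<close>, whose phase is
  opposite; hence the two constants appear interchanged compared with
  \<open>phi_block\<close>.\<close>

lemma phi_block_half:
  assumes "8 \<le> p" "d < 2" "r < 4" "c < 4"
  shows "phi c ((4 * (2 * p + d) + r) div 2) =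
    4 * p + ((2 * d + r div 2) XOR (if block_phase (2 * p + d) then c XOR 2 else c))"
proof -
  have "(4 * (2 * p + d) + r) div 2 = 4 * p + (2 * d + r div 2)" by simp
  moreover have "2 * d + r div 2 < 4" using assms by auto
  ultimately show ?thesis
    using assms by (simp add: phi_block block_phase_double)
qed

text \<open>For \<open>c < 4\<close> and large \<open>a\<close>, let \<open>e\<close> be the
  constant of the block of \<open>a\<close>. Halving \<open>phi c a\<close> acts on the halved
  offset by \<open>e div 2\<close>, whereas the halved block has a constant differing from it by XOR
  with 2 if the phase holds and with 1 otherwise. For \<open>c = 4\<close>, the halved piles differ
  by 1, but \<open>phi 2\<close> moves \<open>a div 2\<close> by 0 or 2.\<close>

lemma phi_halve_leaves:
  assumes "c \<le> 4" "0 < a + phi c a + c"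
  shows "phi (c div 2) (a div 2) \<noteq> phi c a div 2"
proof (cases "a < 64")
  case True
  then show ?thesis
    by (intro phi_halve_leaves_small[rule_format]) (use assms in linarith)+
next
  case False
  then obtain q r where qr: "16 \<le> q" "r < 4" "a = 4 * q + r"
    using block_decomp[of 16 a] by auto
  obtain p d where pd: "8 \<le> p" "d < 2" "q = 2 * p + d"
  proof
    show "8 \<le> q div 2" "q mod 2 < 2" "q = 2 * (q div 2) + q mod 2"
      using qr by auto
  qed
  have c: "c div 2 < 4" "c < 4 \<or> c = 4" using assms by auto
  have d: "d = 0 \<or> d = 1" using pd by auto
  have half: "phi (c div 2) (a div 2) =
      4 * p + ((2 * d + r div 2) XOR (if block_phase q then (c div 2) XOR 2 else c div 2))"
    using phi_block_half[OF pd(1,2) qr(2) c(1)] qr pd by simp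
  from c(2) show ?thesis
  proof
    assume "c = 4"
    then have "phi c a = (if r < 2 then a - 2 else a + 2)" using qr by (simp add: phi_def)
    \<comment> \<open>These are the cases \<open>d = 0\<close> and \<open>r < 2\<close>, where
      \<open>a - 2\<close> falls into the preceding block; \<open>p > 0\<close> keeps the
      subtraction from truncating.\<close>
    moreover have "(8 * p - 2) div 2 \<noteq> 4 * p" "(8 * p - 1) div 2 \<noteq> 4 * p"
      using pd(1) by linarith+
    ultimately show ?thesis using half \<open>c = 4\<close> \<open>r < 4\<close> d pd(3) qr(3)
      by (elim less_four_cases disjE) (auto split: if_splits)
  next
    assume "c < 4"
    then have "phi c a = 4 * q + (r XOR (if block_phase q then c else c XOR 2))"
      using qr by (simp add: phi_block)
    then show ?thesis using half \<open>c < 4\<close> \<open>r < 4\<close> d pd(3)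
      by (elim less_four_cases disjE) (auto split: if_splits)
  qed
qed

lemma phi_reach:
  assumes "c \<le> 4" "b < phi c a" "a < phi c b"
  shows "(\<exists>d<c. phi d a = b) \<or> phi (c div 2) (a div 2) = b div 2"
proof (cases "a < 64")
  case True
  have "b < a + 5" "a < b + 5"
    using assms phi_le[OF assms(1), of a] phi_le[OF assms(1), of b] by linarith+
  then have i: "b + 5 - a < 10" "a + (b + 5 - a) - 5 = b" by linarith+
  have "c < 5" using assms(1) by simp
  from phi_reach_small[rule_format, OF this True i(1)]
  have "(0 < c \<and> phi 0 a = b) \<or> (1 < c \<and> phi 1 a = b) \<or> (2 < c \<and> phi 2 a = b) \<or>
      (3 < c \<and> phi 3 a = b) \<or> phi (c div 2) (a div 2) = b div 2"
    by (simp only: i(2) assms(2,3) simp_thms if_True)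
  then show ?thesis by blast
next
  case False
  have "a < b + 5" using assms phi_le[OF assms(1), of b] by linarith
  \<comment> \<open>34 is \<open>4 * 8 + 2\<close>, the start of the first shifted block covered by
    \<open>phi_four_block\<close>.\<close>
  then have b34: "34 \<le> b" using False by linarith
  have same: "b div 4 = a div 4"
  proof (cases "c = 4")
    case True
    obtain q t where qt: "8 \<le> q" "t < 4" "a = 4 * q + 2 + t"
      using shifted_block_decomp[of 8 a] False by auto
    obtain p u where pu: "8 \<le> p" "u < 4" "b = 4 * p + 2 + u"
      using shifted_block_decomp[of 8 b] b34 by auto
    have "4 * p + 2 + u < 4 * q + 2 + (t XOR 2)" "4 * q + 2 + t < 4 * p + 2 + (u XOR 2)"
      using assms True qt pu by (simp_all only: phi_four_block)
    \<comment> \<open>Both piles lie in the lower half of one shifted block, which is the upper half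
      of an ordinary block.\<close>
    with \<open>t < 4\<close> \<open>u < 4\<close> have "p = q \<and> t < 2 \<and> u < 2"
      by (elim less_four_cases) simp_all
    then have "b div 4 = q" "a div 4 = q" using qt pu by linarith+
    then show ?thesis by simp
  next
    case c: False
    then have "phi c a div 4 = a div 4" "phi c b div 4 = b div 4"
      using assms b34 False by (simp_all add: phi_div_four)
    then have "b div 4 \<le> a div 4" "a div 4 \<le> b div 4"
      using div_le_mono[of b "phi c a" 4] div_le_mono[of a "phi c b" 4] assms by linarith+
    then show ?thesis by simp
  qed
  obtain q r where qr: "16 \<le> q" "r < 4" "a = 4 * q + r"
    using block_decomp[of 16 a] False by auto
  obtain s where s: "s < 4" "b = 4 * q + s"
  proof
    show "b mod 4 < 4" "b = 4 * q + b mod 4" using same qr by auto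
  qed
  consider "c = 4" | "c < 4" using assms by linarith
  then show ?thesis
  proof cases
    case 1
    \<comment> \<open>This solves \<open>phi d a = b\<close>. Any solution below 4 is an admissible
      smaller third pile.\<close>
    define d where "d = (if block_phase q then r XOR s else (r XOR s) XOR 2)"
    have "d < 4" using qr s by (simp add: d_def XOR_less_four)
    moreover have "(s XOR 2) XOR 2 = s" by (simp add: xor.assoc)
    then have "phi d a = 4 * q + s"
      using qr s \<open>d < 4\<close> by (simp add: phi_block d_def flip: xor.assoc)
    ultimately show ?thesis using 1 s by auto
  next
    case 2
    obtain p d where pd: "8 \<le> p" "d < 2" "q = 2 * p + d"
    proof
      show "8 \<le> q div 2" "q mod 2 < 2" "q = 2 * (q div 2) + q mod 2"
        using qr by auto
    qed
    define e where "e = (if block_phase q then c else c XOR 2)"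
    have e: "s < r XOR e" "r < s XOR e"
      using assms 2 qr s by (simp_all add: phi_block e_def)
    have val: "phi d a = 4 * q + (r XOR (if block_phase q then d else d XOR 2))" if "d < 4" for d
      using qr that by (simp add: phi_block)
    have half: "phi (c div 2) (a div 2) =
        4 * p + ((2 * d + r div 2) XOR (if block_phase q then (c div 2) XOR 2 else c div 2))"
      using phi_block_half[OF pd(1,2) qr(2), of "c div 2"] qr pd 2 by simp
    have b2: "b div 2 = 4 * p + (2 * d + s div 2)" using s pd by simp
    have "(\<exists>d<c. r XOR (if block_phase q then d else d XOR 2) = s) \<or>
      (2 * d + r div 2) XOR (if block_phase q then (c div 2) XOR 2 else c div 2) = 2 * d + s div 2"
    proof (cases "block_phase q")
      case True
      have "r XOR s < c"
        using e qr(2) s(1) 2 True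
        by (elim less_four_cases) (simp_all add: e_def)
      then show ?thesis using True by (auto simp flip: xor.assoc)
    next
      case False
      \<comment> \<open>In the second alternative halving wins: the halved block has the opposite
        phase, so there \<open>phi 0\<close> is the identity, and the halved piles agree.\<close>
      have "(r XOR s) XOR 2 < c \<or> r div 2 = s div 2 \<and> c div 2 = 0"
        using e qr(2) s(1) 2 False
        by (elim less_four_cases) (simp_all add: e_def)
      then show ?thesis
      proof
        assume "(r XOR s) XOR 2 < c"
        moreover have "r XOR (((r XOR s) XOR 2) XOR 2) = s"
          by (metis xor.assoc xor.left_neutral xor_self_eq)
        ultimately show ?thesis using False by metis
      qed (use False in simp)
    qed
    then show ?thesis using val half b2 s 2 by auto
  qed
qed

section \<open>Identification with \<open>phi4\<close> and conclusion\<close>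

lemma block_XOR_two:
  fixes q r :: nat
  assumes "r < 4"
  shows "(4 * q + r) XOR 2 = 4 * q + (r XOR 2)"
proof -
  have "(4 * q + r) XOR 2 = of_bool (odd r) + 2 * (((4 * q + r) div 2) XOR 1)"
    by (subst xor_nat_unfold) (auto simp: mod2_eq_if)
  also have "(4 * q + r) div 2 = 2 * q + r div 2" by simp
  finally show ?thesis
    using assms by (elim less_four_cases) (simp_all add: xor_Suc_0_eq)
qed

lemma phi4_table: "\<forall>a<32. phi4 a = phi 4 a"
  by (simp only: all_less_unfold) (simp add: phi4_def shifted_xor_def phi_def phi_table_def)

lemma phi4_eq: "phi4 a = phi 4 a"
proof (cases "a < 32")
  case True
  then show ?thesis using phi4_table by simp
next
  case False
  then obtain q t where qt: "8 \<le> q" "t < 4" "a = 4 * q + t"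
    using block_decomp[of 8 a] by auto
  let ?u = "t XOR 2" and ?q = "if t < 2 then q else q + 1"
  \<comment> \<open>Adding 2 flips bit 1 of the offset and carries into the next block exactly when
    \<open>t\<close> is at least 2. The following XOR with 2 restores the offset but keeps the
    carry.\<close>
  have "a + 2 = 4 * ?q + ?u"
    using qt(2,3) by (elim less_four_cases) simp_all
  moreover have "?u < 4" using qt(2) by (simp add: XOR_less_four)
  moreover have "?u XOR 2 = t" by (simp add: xor.assoc)
  ultimately have "(a + 2) XOR 2 = 4 * ?q + t" by (simp only: block_XOR_two)
  then have "phi4 a = 4 * ?q + t - 2"
    using False by (simp only: phi4_def shifted_xor_def) simp
  moreover have "phi 4 a = (if t < 2 then 4 * q + t - 2 else 4 * q + t + 2)"
    using qt by (simp add: phi_def)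
  ultimately show ?thesis by simp
qed

theorem theorem28:
  shows "(\<forall>a b :: nat. P_position {#a, b, 4#} \<longleftrightarrow> b = phi4 a) \<and>
    (\<forall>a b :: nat. a \<ge> 30 \<and> b \<ge> 30 \<longrightarrow>
      (P_position {#a, b, 4#} \<longleftrightarrow> (a + 2) XOR (b + 2) = 2))"
proof (intro conjI allI impI)
  have main: "P_position {#a, b, 4#} \<longleftrightarrow> b = phi4 a" for a b
    unfolding phi4_eq
    by (rule P_position_triple_criterion[where n = 4])
      (use phi_invol phi_distinct phi_halve_leaves phi_reach in simp_all)
  show "P_position {#a, b, 4#} \<longleftrightarrow> b = phi4 a" for a b
    by (rule main)
  fix a b :: nat
  assume ab: "a \<ge> 30 \<and> b \<ge> 30"
  have "P_position {#a, b, 4#} \<longleftrightarrow> b + 2 = (a + 2) XOR 2"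
    \<comment> \<open>The subtraction in \<open>phi4 a\<close> is exact, so 2 can be added to both
      sides.\<close>
    using ab phi4_no_truncation[of a] by (simp add: main) linarith
  also have "\<dots> \<longleftrightarrow> (a + 2) XOR (b + 2) = 2"
    by (metis xor.assoc xor.left_neutral xor_self_eq)
  finally show "P_position {#a, b, 4#} \<longleftrightarrow> (a + 2) XOR (b + 2) = 2" .
qed

end
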